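(* There are infinitely many cubes which are sums of two tetrahedral numbers; i.e., there are infinitely many positive integers $z$ such that $z^3 = T_x + T_y$ for some positive integers $x, y$.
   Context: $T_n = \frac{n(n+1)(n+2)}{6}$ denotes the $n$-th tetrahedral number. *)

theory Defs
  imports Complex_Main
begin

definition tetrahedral :: "nat \<Rightarrow> nat" where
  "tetrahedral n = n * (n + 1) * (n + 2) div 6"

text \<open>The natural-number division in the definition is exact.\<close>

lemma six_dvd_tetrahedral: "(6::nat) dvd n * (n + 1) * (n + 2)"
proof (induction n)
  case (Suc n)
  have "even ((n + 1) * (n + 2))"
    by simp
  then obtain k where k: "(n + 1) * (n + 2) = 2 * k"
    by (elim evenE)
  have "Suc n * (Suc n + 1) * (Suc n + 2) = n * (n + 1) * (n + 2) + 3 * ((n + 1) * (n + 2))"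
    by (simp add: algebra_simps)
  also have "\<dots> = n * (n + 1) * (n + 2) + 6 * k"
    unfolding k by simp
  finally show ?case
    using Suc.IH by (metis dvd_add dvd_triv_left)
qed simp

lemma six_mult_tetrahedral: "6 * tetrahedral n = n * (n + 1) * (n + 2)"
  unfolding tetrahedral_def using six_dvd_tetrahedral by (rule dvd_mult_div_cancel)

lemma real_tetrahedral: "real (tetrahedral n) = real n * (real n + 1) * (real n + 2) / 6"
proof -
  have "real (6 * tetrahedral n) = real (n * (n + 1) * (n + 2))"
    by (simp only: six_mult_tetrahedral)
  then show ?thesis
    by (simp add: field_simps)
qed

end

theory Submission
  imports Defs "HOL-Library.Infinite_Set"
begin

text \<open>
  With \<open>x + 1 = r + e\<close> and \<open>y + 1 = r - e\<close> one has
  \<open>6 (T\<^sub>x + T\<^sub>y) = 2 r (r\<^sup>2 + 3 e\<^sup>2 - 1)\<close>, which equals \<open>6 r\<^sup>3\<close> as soon as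
  \<open>3 e\<^sup>2 = 2 r\<^sup>2 + 1\<close>. This Pell-type equation has infinitely many solutions, obtained from
  \<open>(e, r) = (9, 11)\<close> by multiplying \<open>e \<surd>3 + r \<surd>2\<close> with the unit \<open>5 + 2 \<surd>6\<close>.
\<close>

lemma tetrahedral_sum_eq_cube:
  fixes e r y :: nat
  assumes pell: "3 * e\<^sup>2 = 2 * r\<^sup>2 + 1" and r: "r = e + y + 1"
  shows "tetrahedral (2 * e + y) + tetrahedral y = r ^ 3"
proof -
  define E Y where "E = int e" and "Y = int y"
  have P: "3 * E\<^sup>2 = 2 * (E + Y + 1)\<^sup>2 + 1"
    using arg_cong[OF pell, of int] by (simp add: r E_def Y_def algebra_simps)
  \<comment> \<open>The difference of the two sides is \<open>2 * (E + Y + 1)\<close> times that of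
    \<open>P\<close>.\<close>
  have "(2 * E + Y) * (2 * E + Y + 1) * (2 * E + Y + 2) + Y * (Y + 1) * (Y + 2)
      = 6 * (E + Y + 1) ^ 3"
    using P by algebra
  then have "int (6 * tetrahedral (2 * e + y) + 6 * tetrahedral y) = int (6 * r ^ 3)"
    unfolding six_mult_tetrahedral by (simp add: r E_def Y_def algebra_simps)
  then show ?thesis
    by linarith
qed

text \<open>The gap \<open>e + 2 \<le> r\<close> serves to make the smaller index
  \<open>r - e - 1\<close> positive.\<close>

lemma pell_3_2_unbounded:
  "\<exists>e r :: nat. n < r \<and> e + 2 \<le> r \<and> 3 * e\<^sup>2 = 2 * r\<^sup>2 + 1"
proof (induction n)
  case 0
  show ?case
    \<comment> \<open>The smaller solution (1, 1) has no gap between \<open>e\<close> and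
      \<open>r\<close>.\<close>
    by (rule exI[of _ 9], rule exI[of _ 11]) simp
next
  case (Suc n)
  then obtain e r :: nat where er: "n < r" "e + 2 \<le> r" "3 * e\<^sup>2 = 2 * r\<^sup>2 + 1"
    by blast
  \<comment> \<open>The unit has norm 25 - 24 = 1, so multiplying by it preserves
    \<open>3 * e\<^sup>2 - 2 * r\<^sup>2\<close>.\<close>
  have "3 * (5 * e + 4 * r)\<^sup>2 = 2 * (6 * e + 5 * r)\<^sup>2 + 1"
    using er(3) by (simp add: power2_eq_square algebra_simps)
  moreover have "Suc n < 6 * e + 5 * r" "5 * e + 4 * r + 2 \<le> 6 * e + 5 * r"
    using er by linarith+
  ultimately show ?case
    by blast
qed

theorem theorem5p4:
  shows "infinite {z::nat. z > 0 \<and> (\<exists>x y :: nat. x > 0 \<and> y > 0 \<and> z ^ 3 = tetrahedral x + tetrahedral y)}"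
  unfolding infinite_nat_iff_unbounded
proof
  fix n :: nat
  obtain e r :: nat where er: "n < r" "e + 2 \<le> r" "3 * e\<^sup>2 = 2 * r\<^sup>2 + 1"
    using pell_3_2_unbounded by blast
  define y where "y = r - e - 1"
  have y: "r = e + y + 1" "y > 0"
    using er(2) by (auto simp: y_def)
  have "r ^ 3 = tetrahedral (2 * e + y) + tetrahedral y"
    using tetrahedral_sum_eq_cube[OF er(3) y(1)] by simp
  moreover have "2 * e + y > 0" "r > 0"
    using y by simp_all
  ultimately show "\<exists>z>n. z \<in> {z. z > 0 \<and> (\<exists>x y :: nat. x > 0 \<and> y > 0 \<and> z ^ 3 = tetrahedral x + tetrahedral y)}"
    using er(1) y(2) by blast
qed

end
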